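(* Let $k\ge 1$, let $\mathcal{X}\subseteq\mathbb{R}^k$ be compact and such that any linearly independent vectors $x_1,\ldots,x_\ell\in\mathcal{X}$ with $\ell<k$ can be completed to a linearly independent set $x_1,\ldots,x_k\in\mathcal{X}$ of size $k$, and let $c\in\mathbb{R}^k$ be nonzero. Let $x_1,\ldots,x_\ell\in\mathcal{X}$, $\ell\le k$, be linearly independent and such that $c\in\mathrm{span}(x_1,\ldots,x_\ell)$. With $\xi^*(x_1,\ldots,x_\ell)$, $z^*(x_1,\ldots,x_\ell)$, $\Xi$, $\Xi(x_1,\ldots,x_\ell)$, $\Psi$ and $R(c)$ as defined in the context, the following hold. 1. $\xi^*(x_1,\ldots,x_\ell)$ and $z^*(x_1,\ldots,x_\ell)$ are invariant with respect to the choice of generalized inverse $M^{-1}$ used in their definition. 2. $z^*(x_1,\ldots,x_\ell)\in R(c)$. 3. $\xi^*(x_1,\ldots,x_\ell)\in\Xi$. 4. $\Psi(\xi^*(x_1,\ldots,x_\ell))=\|c\|^2/\|z^*(x_1,\ldots,x_\ell)\|^2$. 5. $\xi^*(x_1,\ldots,x_\ell)=\arg\min_{\xi\in\Xi(x_1,\ldots,x_\ell)}\Psi(\xi)$, i.e. $\xi^*(x_1,\ldots,x_\ell)$ is the minimizer of $\Psi$ over $\Xi(x_1,\ldots,x_\ell)$.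
   Context: Prime denotes transpose and $\|\cdot\|$ is the Euclidean norm on $\mathbb{R}^k$. A design is a probability measure $\xi$ on $\mathcal{X}$; $\{(x_i,p_i)\}_{i=1}^\ell$ (with $p_i\ge 0$, $\sum_i p_i=1$) denotes the design putting weight $p_i$ on the point $x_i$. The information matrix of a measure $\xi$ on $\mathcal{X}$ is $M(\xi)=\int_{\mathcal{X}}xx'\,\xi(dx)$, so $M(\{(x_i,p_i)\}_{i=1}^\ell)=\sum_{i=1}^\ell p_ix_ix_i'$. The class of designs for which $c'\theta$ is estimable is $$\Xi=\left\{\xi:\ \int_{\mathcal{X}}\xi(dx)=1\ \text{ and }\ c=M(\xi)d\ \text{ for some } d\in\mathbb{R}^k\right\},$$ and $\Xi(x_1,\ldots,x_\ell)=\{\xi\in\Xi:\ \mathrm{supp}(\xi)\subseteq\{x_1,\ldots,x_\ell\}\}$. For $\xi\in\Xi$ put $\Psi(\xi)=c'M(\xi)^{-1}c$, where, if $M(\xi)$ is singular, $M(\xi)^{-1}$ means any generalized inverse of $M(\xi)$ (a matrix $G$ with $M(\xi)GM(\xi)=M(\xi)$); the value of $\Psi(\xi)$ does not depend on which generalized inverse is chosen. Also $R(c)=\{\gamma c\in\mathbb{R}^k:\gamma\in\mathbb{R}\}$. For linearly independent $x_1,\ldots,x_\ell\in\mathcal{X}$, $\ell\le k$, such that $c\in\mathrm{span}(x_1,\ldots,x_\ell)$, let $M=M(\{(x_i,1/\ell)\}_{i=1}^\ell)=\ell^{-1}\sum_{i=1}^\ell x_ix_i'$, let $M^{-1}$ be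 any generalized inverse of $M$ (a matrix $G$ with $MGM=M$), and define, for $i=1,\ldots,\ell$, $$\varepsilon_i^*=\mathrm{sign}(x_i'M^{-1}c),\qquad p_i^*=\frac{|x_i'M^{-1}c|}{\sum_{j=1}^\ell|x_j'M^{-1}c|},$$ $$\xi^*(x_1,\ldots,x_\ell)=\{(x_i,p_i^* )\}_{i=1}^\ell,\qquad z^*(x_1,\ldots,x_\ell)=\sum_{i=1}^\ell\varepsilon_i^*p_i^*x_i.$$ (The value assigned to $\mathrm{sign}(0)$ is immaterial for $\xi^*$ and $z^*$, since then $p_i^*=0$.) *)

theory Defs
  imports "HOL-Probability.Probability"
begin

text \<open>
  Measures on \<open>X\<close> live on the Borel sigma-algebra of the subspace \<open>X\<close>,
  so that equality of designs is equality of Isabelle measures.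
\<close>

definition design :: "(real^'k) set \<Rightarrow> (real^'k) measure \<Rightarrow> bool" where
  "design X \<xi> \<longleftrightarrow> sets \<xi> = sets (restrict_space borel X) \<and> prob_space \<xi>"

definition finite_design ::
  "(real^'k) set \<Rightarrow> nat \<Rightarrow> (nat \<Rightarrow> real^'k) \<Rightarrow> (nat \<Rightarrow> real) \<Rightarrow> (real^'k) measure" where
  "finite_design X l x p =
     distr (point_measure {1..l} (\<lambda>i. ennreal (p i))) (restrict_space borel X) x"

definition supp :: "(real^'k) measure \<Rightarrow> (real^'k) set" where
  "supp \<xi> = {x \<in> space \<xi>. \<forall>U. open U \<and> x \<in> U \<longrightarrow> emeasure \<xi> (U \<inter> space \<xi>) > 0}"

definition outer :: "real^'k \<Rightarrow> real^'k^'k" where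
  "outer x = (\<chi> i j. x $ i * x $ j)"

definition info_matrix :: "(real^'k) measure \<Rightarrow> real^'k^'k" where
  "info_matrix \<xi> = (\<integral>x. outer x \<partial>\<xi>)"

definition is_ginv :: "real^'k^'k \<Rightarrow> real^'k^'k \<Rightarrow> bool" where
  "is_ginv M G \<longleftrightarrow> M ** G ** M = M"

definition Xi :: "(real^'k) set \<Rightarrow> real^'k \<Rightarrow> (real^'k) measure set" where
  "Xi X c = {\<xi>. design X \<xi> \<and> (\<exists>d. c = info_matrix \<xi> *v d)}"

definition Xi_on ::
  "(real^'k) set \<Rightarrow> real^'k \<Rightarrow> nat \<Rightarrow> (nat \<Rightarrow> real^'k) \<Rightarrow> (real^'k) measure set" where
  "Xi_on X c l x = {\<xi> \<in> Xi X c. supp \<xi> \<subseteq> x ` {1..l}}"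

text \<open>
  The choice made by \<open>SOME\<close> is immaterial on \<open>Xi X c\<close>: see \<open>is_ginv_exists\<close> and \<open>Psi_eq\<close> below.
\<close>

definition Psi :: "real^'k \<Rightarrow> (real^'k) measure \<Rightarrow> real" where
  "Psi c \<xi> = c \<bullet> ((SOME G. is_ginv (info_matrix \<xi>) G) *v c)"

definition uniform_info :: "(real^'k) set \<Rightarrow> nat \<Rightarrow> (nat \<Rightarrow> real^'k) \<Rightarrow> real^'k^'k" where
  "uniform_info X l x = info_matrix (finite_design X l x (\<lambda>i. 1 / real l))"

text \<open>
  In the next definitions \<open>G\<close> stands for the chosen generalized inverse of \<open>uniform_info X l x\<close>.
\<close>

definition eps_star ::
  "(nat \<Rightarrow> real^'k) \<Rightarrow> real^'k \<Rightarrow> real^'k^'k \<Rightarrow> nat \<Rightarrow> real" where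
  "eps_star x c G i = sgn (x i \<bullet> (G *v c))"

definition p_star ::
  "nat \<Rightarrow> (nat \<Rightarrow> real^'k) \<Rightarrow> real^'k \<Rightarrow> real^'k^'k \<Rightarrow> nat \<Rightarrow> real" where
  "p_star l x c G i = \<bar>x i \<bullet> (G *v c)\<bar> / (\<Sum>j=1..l. \<bar>x j \<bullet> (G *v c)\<bar>)"

definition xi_star ::
  "(real^'k) set \<Rightarrow> nat \<Rightarrow> (nat \<Rightarrow> real^'k) \<Rightarrow> real^'k \<Rightarrow> real^'k^'k \<Rightarrow> (real^'k) measure" where
  "xi_star X l x c G = finite_design X l x (p_star l x c G)"

definition z_star ::
  "nat \<Rightarrow> (nat \<Rightarrow> real^'k) \<Rightarrow> real^'k \<Rightarrow> real^'k^'k \<Rightarrow> real^'k" where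
  "z_star l x c G = (\<Sum>i=1..l. (eps_star x c G i * p_star l x c G i) *\<^sub>R x i)"

definition line :: "real^'k \<Rightarrow> (real^'k) set" where
  "line c = {\<gamma> *\<^sub>R c | \<gamma>. True}"

lemma is_ginv_exists:
  fixes M :: "real^'k^'k"
  shows "\<exists>G. is_ginv M G"
proof -
  obtain g where g: "linear g" "\<forall>v\<in>range ((*v) M). M *v g v = v"
    using linear_exists_right_inverse_on[OF matrix_vector_mul_linear[of M] subspace_UNIV]
    by auto
  have "(M ** matrix g ** M) *v v = M *v v" for v
    using g(2) by (simp add: matrix_vector_mul_assoc[symmetric] matrix_works[OF g(1)[folded linear_matrix_vector_mul_eq]])
  then have "M ** matrix g ** M = M"
    by (simp add: matrix_eq)
  then show ?thesis
    unfolding is_ginv_def by blast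
qed

lemma transpose_info_matrix: "transpose (info_matrix \<xi>) = info_matrix \<xi>"
proof (cases "integrable \<xi> outer")
  case True
  have L: "bounded_linear (\<lambda>A::real^'k^'k. A $ i $ j)" for i j
    by (intro bounded_linear_compose[OF bounded_linear_vec_nth bounded_linear_vec_nth])
  have "info_matrix \<xi> $ i $ j = (\<integral>x. outer x $ i $ j \<partial>\<xi>)" for i j
    using integral_bounded_linear[OF L True] by (simp add: info_matrix_def)
  then show ?thesis
    by (simp add: transpose_def vec_eq_iff outer_def mult.commute)
next
  case False
  then show ?thesis
    by (simp add: info_matrix_def not_integrable_integral_eq transpose_def vec_eq_iff)
qed

lemma Psi_eq:
  assumes "\<xi> \<in> Xi X c" "is_ginv (info_matrix \<xi>) G"
  shows "Psi c \<xi> = c \<bullet> (G *v c)"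
proof -
  let ?M = "info_matrix \<xi>"
  obtain d where d: "c = ?M *v d"
    using assms(1) by (auto simp: Xi_def)
  have *: "c \<bullet> (H *v c) = d \<bullet> (?M *v d)" if "is_ginv ?M H" for H
  proof -
    have "c \<bullet> (H *v c) = d \<bullet> (?M *v (H *v (?M *v d)))"
      using d dot_lmul_matrix[of d ?M "H *v c"]
      by (metis transpose_info_matrix transpose_matrix_vector)
    also have "\<dots> = d \<bullet> ((?M ** H ** ?M) *v d)"
      by (simp add: matrix_vector_mul_assoc matrix_mul_assoc)
    finally show ?thesis
      using that by (simp add: is_ginv_def)
  qed
  show ?thesis
    unfolding Psi_def using *[OF someI_ex[OF is_ginv_exists]] *[OF assms(2)] by simp
qed

lemma info_matrix_finite_design:
  assumes "x ` {1..l} \<subseteq> X" "\<And>i. i \<in> {1..l} \<Longrightarrow> p i \<ge> 0"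
  shows "info_matrix (finite_design X l x p) = (\<Sum>i=1..l. p i *\<^sub>R outer (x i))"
proof -
  have "continuous_on UNIV (outer :: real^'k \<Rightarrow> _)"
    unfolding outer_def by (intro continuous_intros)
  then have "outer \<in> borel_measurable (borel :: (real^'k) measure)"
    by (rule borel_measurable_continuous_onI)
  then have m: "outer \<in> borel_measurable (restrict_space borel X)"
    by (rule measurable_restrict_space1)
  have x: "x \<in> point_measure {1..l} (\<lambda>i. ennreal (p i)) \<rightarrow>\<^sub>M restrict_space borel X"
    using assms(1) by (auto simp: point_measure_def space_restrict_space)
  show ?thesis
    unfolding info_matrix_def finite_design_def integral_distr[OF x m]
    by (subst lebesgue_integral_point_measure_finite) (use assms in auto)
qed

end

theory Submission
  imports Defs
begin

text \<open>
  Write \<open>c = \<Sum>i. a\<^sub>i x\<^sub>i\<close>, which determines the coefficients \<open>a\<close> because the \<open>x\<^sub>i\<close> are independent,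
  and put \<open>S = \<Sum>i. \<bar>a\<^sub>i\<bar>\<close>, which is positive since \<open>c \<noteq> 0\<close>.

  For a design with weights \<open>p\<close> on the \<open>x\<^sub>i\<close> the information matrix maps \<open>d\<close> to
  \<open>\<Sum>i. p\<^sub>i (x\<^sub>i \<bullet> d) x\<^sub>i\<close>. Comparing coefficients, \<open>c\<close> is the image of \<open>d\<close> if and only if
  \<open>p\<^sub>i (x\<^sub>i \<bullet> d) = a\<^sub>i\<close> for all \<open>i\<close>; and independence also lets the numbers \<open>x\<^sub>i \<bullet> d\<close> be prescribed
  freely (\<open>dual_vector_exists\<close>). For the uniform design, \<open>c\<close> is therefore in the range of \<open>M\<close>, so
  \<open>M (G c) = c\<close> for every generalized inverse \<open>G\<close> and \<open>x\<^sub>i \<bullet> G c = l a\<^sub>i\<close>, whatever \<open>G\<close> is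
  (\<open>ginv_coefficients\<close>). Hence \<open>p\<^sup>*\<^sub>i = \<bar>a\<^sub>i\<bar> / S\<close> and \<open>z\<^sup>* = c / S\<close>, which gives the invariance and
  \<open>z\<^sup>* \<in> R(c)\<close>, and turns \<open>\<Psi>(\<xi>\<^sup>*) = \<parallel>c\<parallel>\<^sup>2 / \<parallel>z\<^sup>*\<parallel>\<^sup>2\<close> into \<open>\<Psi>(\<xi>\<^sup>*) = S\<^sup>2\<close>.

  If \<open>c\<close> is the image of \<open>d\<close>, then \<open>\<Psi>(\<xi>) = c \<bullet> d = \<Sum>i. p\<^sub>i (x\<^sub>i \<bullet> d)\<^sup>2\<close>, and completing the square gives
  \<open>\<Psi>(\<xi>) - S\<^sup>2 = \<Sum>i. p\<^sub>i (\<bar>x\<^sub>i \<bullet> d\<bar> - S)\<^sup>2\<close>. This is nonnegative, and it vanishes only if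
  \<open>\<bar>a\<^sub>i\<bar> = p\<^sub>i S\<close> for all \<open>i\<close>, that is, only for \<open>p = p\<^sup>*\<close> (\<open>Psi_lower_bound\<close>). These weights
  do satisfy the solvability condition, with \<open>x\<^sub>i \<bullet> d = sgn a\<^sub>i S\<close>, and attain \<open>S\<^sup>2\<close>
  (\<open>optimal_weights\<close>); so \<open>\<xi>\<^sup>*\<close> is the unique minimizer among weighted designs on the \<open>x\<^sub>i\<close>. The last ingredient is that these are all the designs
  supported there: the complement of the support is null because the topology has a countable
  base (\<open>finite_supp_imp_finite_design\<close>).
\<close>

section \<open>Linear algebra of independent families\<close>

lemma independent_family_coeffs_eq:
  fixes x :: "'i \<Rightarrow> 'a::real_vector"
  assumes "finite I" "inj_on x I" "independent (x ` I)"
    and "(\<Sum>i\<in>I. u i *\<^sub>R x i) = (\<Sum>i\<in>I. v i *\<^sub>R x i)" and "i \<in> I"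
  shows "u i = v i"
proof -
  let ?w = "\<lambda>y. u (the_inv_into I x y) - v (the_inv_into I x y)"
  have "(\<Sum>y\<in>x ` I. ?w y *\<^sub>R y) = (\<Sum>i\<in>I. (u i - v i) *\<^sub>R x i)"
    using assms(2) by (simp add: sum.reindex the_inv_into_f_f)
  also have "\<dots> = 0"
    using assms(4) by (simp add: scaleR_left_diff_distrib sum_subtractf)
  finally have "?w (x i) = 0"
    using independentD[OF assms(3), of "x ` I" ?w "x i"] assms(1,5) by blast
  then show ?thesis
    using assms(2,5) by (simp add: the_inv_into_f_f)
qed

lemma span_family_coeffs:
  fixes x :: "'i \<Rightarrow> 'a::real_vector"
  assumes "finite I" "inj_on x I" "c \<in> span (x ` I)"
  obtains a where "c = (\<Sum>i\<in>I. a i *\<^sub>R x i)"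
proof -
  obtain u where "c = (\<Sum>y\<in>x ` I. u y *\<^sub>R y)"
    using assms(1,3) by (auto simp: span_finite)
  then have "c = (\<Sum>i\<in>I. u (x i) *\<^sub>R x i)"
    using assms(2) by (simp add: sum.reindex)
  then show thesis by (rule that)
qed

text \<open>
  A linear functional can take any values on an independent family, and every linear functional on
  a Euclidean space is an inner product with a fixed vector.
\<close>

lemma dual_vector_exists:
  fixes x :: "'i \<Rightarrow> 'a::euclidean_space"
  assumes "inj_on x I" "independent (x ` I)"
  obtains d where "\<And>i. i \<in> I \<Longrightarrow> x i \<bullet> d = b i"
proof -
  obtain f :: "'a \<Rightarrow> real" where f: "linear f" "\<forall>y\<in>x ` I. f y = b (the_inv_into I x y)"
    using linear_independent_extend[OF assms(2), of "\<lambda>y. b (the_inv_into I x y)"] by auto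
  have "x i \<bullet> adjoint f 1 = b i" if "i \<in> I" for i
  proof -
    have "x i \<bullet> adjoint f 1 = f (x i)"
      using adjoint_works[OF f(1), of "x i" 1] by simp
    also have "\<dots> = b i"
      using that assms(1) f(2) by (simp add: the_inv_into_f_f)
    finally show ?thesis .
  qed
  then show thesis by (rule that)
qed

section \<open>Information matrices of finitely supported designs\<close>

lemma outer_mult_vec: "outer v *v d = (v \<bullet> d) *\<^sub>R v"
proof -
  have "(\<Sum>j\<in>UNIV. v $ i * v $ j * d $ j) = (\<Sum>j\<in>UNIV. v $ j * d $ j) * v $ i" for i
    by (subst sum_distrib_right) (rule sum.cong[OF refl], simp)
  then show ?thesis
    by (simp only: vec_eq_iff outer_def matrix_vector_mult_def inner_vec_def vec_lambda_beta
        vector_scaleR_component inner_real_def real_scaleR_def simp_thms)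
qed

lemma info_matrix_finite_design_mult_vec:
  assumes "x ` {1..l} \<subseteq> X" "\<And>i. i \<in> {1..l} \<Longrightarrow> p i \<ge> 0"
  shows "info_matrix (finite_design X l x p) *v d = (\<Sum>i=1..l. (p i * (x i \<bullet> d)) *\<^sub>R x i)"
proof -
  have "(\<Sum>i\<in>A. p i *\<^sub>R outer (x i)) *v d = (\<Sum>i\<in>A. (p i * (x i \<bullet> d)) *\<^sub>R x i)" for A :: "nat set"
    by (induction A rule: infinite_finite_induct)
      (simp_all add: matrix_vector_mult_add_rdistrib outer_mult_vec flip: scaleR_matrix_vector_assoc)
  then show ?thesis
    by (simp only: info_matrix_finite_design[OF assms])
qed

text \<open>
  The coefficients of \<open>c\<close> in the family are recovered, up to the factor \<open>l\<close>, from any generalized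
  inverse: since \<open>c = M d\<close> for some \<open>d\<close>, one has \<open>M G c = M G M d = c\<close>, and the coefficients of
  \<open>M G c\<close> are \<open>(x\<^sub>i \<bullet> G c) / l\<close>.
\<close>

lemma ginv_coefficients:
  fixes x :: "nat \<Rightarrow> real^'k"
  assumes x_in: "x ` {1..l} \<subseteq> X" and inj: "inj_on x {1..l}" and ind: "independent (x ` {1..l})"
    and c: "c = (\<Sum>i=1..l. a i *\<^sub>R x i)"
    and G: "is_ginv (uniform_info X l x) G" and i: "i \<in> {1..l}"
  shows "x i \<bullet> (G *v c) = real l * a i"
proof -
  let ?M = "uniform_info X l x"
  have M: "?M *v d = (\<Sum>i=1..l. (1 / real l * (x i \<bullet> d)) *\<^sub>R x i)" for d
    unfolding uniform_info_def by (rule info_matrix_finite_design_mult_vec[OF x_in]) simp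
  have l: "real l \<noteq> 0" using i by auto
  obtain d where d: "\<And>i. i \<in> {1..l} \<Longrightarrow> x i \<bullet> d = real l * a i"
    using dual_vector_exists[OF inj ind, of "\<lambda>i. real l * a i"] by blast
  have Md: "?M *v d = c"
    unfolding M c using l by (intro sum.cong) (simp_all add: d)
  have "?M *v (G *v c) = (?M ** G ** ?M) *v d"
    by (simp add: Md[symmetric] matrix_vector_mul_assoc matrix_mul_assoc)
  also have "\<dots> = c"
    using G Md by (simp add: is_ginv_def)
  finally have "(\<Sum>i=1..l. (1 / real l * (x i \<bullet> (G *v c))) *\<^sub>R x i) = (\<Sum>i=1..l. a i *\<^sub>R x i)"
    using M c by simp
  from independent_family_coeffs_eq[OF _ inj ind this i] show ?thesis
    using l by (simp add: field_simps)
qed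

section \<open>Designs supported on finitely many points\<close>

lemma measurable_into_restrict_borel:
  fixes x :: "nat \<Rightarrow> 'a::topological_space"
  assumes "x ` {1..l} \<subseteq> X"
  shows "x \<in> point_measure {1..l} p \<rightarrow>\<^sub>M restrict_space borel X"
proof (rule measurable_restrict_space2)
  show "x \<in> space (point_measure {1..l} p) \<rightarrow> X"
    using assms by (auto simp: space_point_measure)
  show "x \<in> borel_measurable (point_measure {1..l} p)"
    unfolding point_measure_def by (subst measurable_cong_sets[OF sets_density refl]) simp
qed

lemma emeasure_finite_design:
  assumes "x ` {1..l} \<subseteq> X" "A \<in> sets (restrict_space borel X)"
  shows "emeasure (finite_design X l x p) A = (\<Sum>i | i \<in> {1..l} \<and> x i \<in> A. ennreal (p i))"
proof -
  have "emeasure (finite_design X l x p) A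
      = emeasure (point_measure {1..l} (\<lambda>i. ennreal (p i))) {i \<in> {1..l}. x i \<in> A}"
    unfolding finite_design_def emeasure_distr[OF measurable_into_restrict_borel[OF assms(1)] assms(2)]
    by (simp add: space_point_measure Int_def vimage_def conj_commute)
  also have "\<dots> = (\<Sum>i | i \<in> {1..l} \<and> x i \<in> A. ennreal (p i))"
    by (subst emeasure_point_measure_finite) auto
  finally show ?thesis .
qed

lemma sets_finite_design [simp]: "sets (finite_design X l x p) = sets (restrict_space borel X)"
  by (simp add: finite_design_def)

lemma space_finite_design [simp]: "space (finite_design X l x p) = X"
  by (simp add: finite_design_def space_restrict_space)

lemma design_finite_design:
  assumes "x ` {1..l} \<subseteq> X" "\<And>i. i \<in> {1..l} \<Longrightarrow> p i \<ge> 0" "(\<Sum>i=1..l. p i) = 1"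
  shows "design X (finite_design X l x p)"
proof -
  have "X \<in> sets (restrict_space borel X)"
    using sets.top[of "restrict_space borel X"] by (simp add: space_restrict_space)
  moreover have "{i. i \<in> {1..l} \<and> x i \<in> X} = {1..l}"
    using assms(1) by auto
  ultimately have "emeasure (finite_design X l x p) X = (\<Sum>i=1..l. ennreal (p i))"
    by (simp only: emeasure_finite_design[OF assms(1)])
  also have "\<dots> = ennreal (\<Sum>i=1..l. p i)"
    by (rule sum_ennreal) (rule assms(2))
  finally have "emeasure (finite_design X l x p) X = 1"
    using assms(3) by simp
  then show ?thesis
    by (auto simp: design_def intro!: prob_spaceI)
qed

lemma supp_finite_design:
  assumes "x ` {1..l} \<subseteq> X"
  shows "supp (finite_design X l x p) \<subseteq> x ` {1..l}"
proof
  fix y assume y: "y \<in> supp (finite_design X l x p)"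
  show "y \<in> x ` {1..l}"
  proof (rule ccontr)
    let ?U = "- x ` {1..l}"
    assume "y \<notin> x ` {1..l}"
    moreover have U: "open ?U"
      by (intro open_Compl finite_imp_closed) simp
    ultimately have pos: "emeasure (finite_design X l x p) (?U \<inter> X) > 0"
      using y by (auto simp: supp_def)
    have "?U \<inter> X \<in> sets (restrict_space borel X)"
      using U by (auto simp: sets_restrict_space)
    then have "emeasure (finite_design X l x p) (?U \<inter> X)
        = (\<Sum>i | i \<in> {1..l} \<and> x i \<in> ?U \<inter> X. ennreal (p i))"
      by (rule emeasure_finite_design[OF assms])
    also have "\<dots> = 0"
      by (rule sum.neutral) auto
    finally show False
      using pos by (simp only: less_irrefl)
  qed
qed

text \<open>
  Every point of \<open>X\<close> outside the support has an open neighbourhood with null trace on \<open>X\<close>, and by the Lindelof property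
  countably many of these neighbourhoods already cover the complement.
\<close>

lemma emeasure_outside_supp:
  fixes \<xi> :: "(real^'k) measure"
  assumes "sets \<xi> = sets (restrict_space borel X)" "A \<in> sets \<xi>" "A \<inter> supp \<xi> = {}"
  shows "emeasure \<xi> A = 0"
proof -
  define F where "F = {U. open U \<and> emeasure \<xi> (U \<inter> space \<xi>) = 0}"
  have sp: "space \<xi> = X"
    using sets_eq_imp_space_eq[OF assms(1)] by (simp add: space_restrict_space)
  obtain F' where F': "F' \<subseteq> F" "countable F'" "\<Union>F' = \<Union>F"
    using Lindelof[of F] unfolding F_def by blast
  have "A \<subseteq> \<Union>F"
  proof
    fix y assume "y \<in> A"
    then have "y \<in> space \<xi>" "y \<notin> supp \<xi>"
      using assms(3) sets.sets_into_space[OF assms(2)] by blast+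
    then show "y \<in> \<Union>F"
      by (auto simp: supp_def F_def zero_less_iff_neq_zero)
  qed
  then have sub: "A \<subseteq> (\<Union>U\<in>F'. U \<inter> space \<xi>)"
    using F'(3) sets.sets_into_space[OF assms(2)] by blast
  have "U \<inter> space \<xi> \<in> null_sets \<xi>" if "U \<in> F'" for U
  proof -
    have "open U" "emeasure \<xi> (U \<inter> space \<xi>) = 0"
      using that F'(1) by (auto simp: F_def)
    moreover have "U \<inter> X \<in> sets \<xi>"
      using \<open>open U\<close> unfolding assms(1) by (auto simp: sets_restrict_space)
    ultimately show ?thesis
      by (simp add: null_sets_def sp)
  qed
  then have "(\<Union>U\<in>F'. U \<inter> space \<xi>) \<in> null_sets \<xi>"
    using F'(2) by (intro null_sets_UN') auto
  then show ?thesis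
    using null_sets_subset[OF _ assms(2) sub] by blast
qed

lemma finite_supp_imp_finite_design:
  fixes x :: "nat \<Rightarrow> real^'k"
  assumes des: "design X \<xi>" and supp: "supp \<xi> \<subseteq> x ` {1..l}"
    and x_in: "x ` {1..l} \<subseteq> X" and inj: "inj_on x {1..l}"
  obtains p where "\<And>i. i \<in> {1..l} \<Longrightarrow> p i \<ge> 0" "(\<Sum>i=1..l. p i) = 1"
    "\<xi> = finite_design X l x p"
proof -
  interpret prob_space \<xi> using des by (simp add: design_def)
  have sets: "sets \<xi> = sets (restrict_space borel X)"
    using des by (simp add: design_def)
  have sp: "space \<xi> = X"
    using sets_eq_imp_space_eq[OF sets] by (simp add: space_restrict_space)
  define p where "p i = measure \<xi> {x i}" for i
  have single: "{x i} \<in> sets \<xi>" if "i \<in> {1..l}" for i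
  proof -
    have "{x i} = X \<inter> {x i}" using x_in that by auto
    then show ?thesis unfolding sets by (auto simp: sets_restrict_space)
  qed
  have em: "emeasure \<xi> A = (\<Sum>i | i \<in> {1..l} \<and> x i \<in> A. ennreal (p i))" if A: "A \<in> sets \<xi>" for A
  proof -
    let ?J = "{i \<in> {1..l}. x i \<in> A}"
    have J: "x ` ?J \<in> sets \<xi>"
      using sets.finite_UN[of ?J "\<lambda>i. {x i}" \<xi>] single by (simp add: UNION_singleton_eq_range)
    have sub: "x ` ?J \<subseteq> A" by auto
    have "A - x ` ?J \<in> sets \<xi>" using A J by auto
    moreover have "(A - x ` ?J) \<inter> supp \<xi> = {}" using supp by auto
    ultimately have "emeasure \<xi> (A - x ` ?J) = 0"
      using emeasure_outside_supp[OF sets] by blast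
    then have "emeasure \<xi> A = emeasure \<xi> (x ` ?J)"
      using plus_emeasure[OF J \<open>A - x ` ?J \<in> sets \<xi>\<close>] sub by (simp add: Un_absorb1)
    also have "\<dots> = (\<Sum>y\<in>x ` ?J. emeasure \<xi> {y})"
      using single by (intro emeasure_eq_sum_singleton) auto
    also have "\<dots> = (\<Sum>i\<in>?J. emeasure \<xi> {x i})"
      by (subst sum.reindex) (auto intro: inj_on_subset[OF inj])
    finally show ?thesis
      by (simp add: p_def emeasure_eq_measure)
  qed
  have eq: "\<xi> = finite_design X l x p"
    by (rule measure_eqI) (simp_all add: sets em emeasure_finite_design[OF x_in])
  have "{i. i \<in> {1..l} \<and> x i \<in> space \<xi>} = {1..l}"
    using x_in by (auto simp: sp)
  then have "ennreal (\<Sum>i=1..l. p i) = 1"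
    using em[OF sets.top] emeasure_space_1 by (simp add: sum_ennreal p_def)
  then have "(\<Sum>i=1..l. p i) = 1"
    by (simp add: ennreal_eq_1)
  then show thesis
    using eq by (intro that) (auto simp: p_def)
qed

section \<open>The variance criterion on weighted designs\<close>

text \<open>
  Every solution \<open>d\<close> of \<open>c = M d\<close> can play the role of \<open>M\<^sup>-\<^sup>1 c\<close>, because \<open>c' G c = d' M G M d = d' M d\<close>.
\<close>

lemma Psi_eq_inner_solution:
  assumes "design X \<xi>" "c = info_matrix \<xi> *v d"
  shows "Psi c \<xi> = c \<bullet> d"
proof -
  let ?M = "info_matrix \<xi>"
  obtain G where G: "is_ginv ?M G" using is_ginv_exists by blast
  have "\<xi> \<in> Xi X c" using assms by (auto simp: Xi_def)
  then have "Psi c \<xi> = c \<bullet> (G *v c)" using G by (rule Psi_eq)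
  also have "\<dots> = d \<bullet> (?M *v (G *v (?M *v d)))"
    using assms(2) dot_lmul_matrix[of d ?M "G *v c"]
    by (metis transpose_info_matrix transpose_matrix_vector)
  also have "\<dots> = d \<bullet> ((?M ** G ** ?M) *v d)"
    by (simp add: matrix_vector_mul_assoc matrix_mul_assoc)
  also have "\<dots> = c \<bullet> d"
    using G assms(2) by (simp add: is_ginv_def inner_commute)
  finally show ?thesis .
qed

text \<open>
  Completing the square: with \<open>p\<^sub>i y\<^sub>i = a\<^sub>i\<close> and \<open>\<Sum>i. p\<^sub>i = 1\<close>, the cross term of
  \<open>\<Sum>i. p\<^sub>i (\<bar>y\<^sub>i\<bar> - S)\<^sup>2\<close> is \<open>- 2 S \<Sum>i. \<bar>a\<^sub>i\<bar> = - 2 S\<^sup>2\<close>.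
\<close>

lemma weighted_squares_excess:
  fixes p y a :: "'i \<Rightarrow> real"
  assumes p: "\<And>i. i \<in> I \<Longrightarrow> p i \<ge> 0" "(\<Sum>i\<in>I. p i) = 1"
    and a: "\<And>i. i \<in> I \<Longrightarrow> p i * y i = a i" and S: "S = (\<Sum>i\<in>I. \<bar>a i\<bar>)"
  shows "(\<Sum>i\<in>I. p i * (y i)\<^sup>2) - S\<^sup>2 = (\<Sum>i\<in>I. p i * (\<bar>y i\<bar> - S)\<^sup>2)"
proof -
  have "(\<Sum>i\<in>I. p i * (\<bar>y i\<bar> - S)\<^sup>2) = (\<Sum>i\<in>I. p i * (y i)\<^sup>2 - 2 * S * \<bar>a i\<bar> + S\<^sup>2 * p i)"
  proof (rule sum.cong[OF refl])
    fix i assume i: "i \<in> I"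
    have "\<bar>a i\<bar> = p i * \<bar>y i\<bar>"
      using a[OF i, symmetric] p(1)[OF i] by (simp add: abs_mult)
    then show "p i * (\<bar>y i\<bar> - S)\<^sup>2 = p i * (y i)\<^sup>2 - 2 * S * \<bar>a i\<bar> + S\<^sup>2 * p i"
      by (simp add: power2_diff algebra_simps)
  qed
  also have "\<dots> = (\<Sum>i\<in>I. p i * (y i)\<^sup>2) - 2 * S * S + S\<^sup>2"
    by (simp add: sum.distrib sum_subtractf sum_distrib_left[symmetric] S[symmetric] p(2))
  finally show ?thesis
    by (simp add: power2_eq_square)
qed

lemma Psi_weighted_design:
  fixes x :: "nat \<Rightarrow> real^'k"
  assumes "x ` {1..l} \<subseteq> X" "\<And>i. i \<in> {1..l} \<Longrightarrow> p i \<ge> 0" "(\<Sum>i=1..l. p i) = 1"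
    and c: "c = info_matrix (finite_design X l x p) *v d"
  shows "Psi c (finite_design X l x p) = (\<Sum>i=1..l. p i * (x i \<bullet> d)\<^sup>2)"
proof -
  have sum: "c = (\<Sum>i=1..l. (p i * (x i \<bullet> d)) *\<^sub>R x i)"
    unfolding c by (rule info_matrix_finite_design_mult_vec) (use assms in auto)
  have "Psi c (finite_design X l x p) = c \<bullet> d"
    by (rule Psi_eq_inner_solution[OF design_finite_design c]) (use assms in auto)
  also have "\<dots> = (\<Sum>i=1..l. p i * (x i \<bullet> d)\<^sup>2)"
    by (subst sum) (simp add: inner_sum_left power2_eq_square mult.assoc)
  finally show ?thesis .
qed

lemma Psi_lower_bound:
  fixes x :: "nat \<Rightarrow> real^'k"
  assumes x_in: "x ` {1..l} \<subseteq> X" and inj: "inj_on x {1..l}" and ind: "independent (x ` {1..l})"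
    and c: "c = (\<Sum>i=1..l. a i *\<^sub>R x i)"
    and p: "\<And>i. i \<in> {1..l} \<Longrightarrow> p i \<ge> 0" "(\<Sum>i=1..l. p i) = 1"
    and Xi: "finite_design X l x p \<in> Xi X c"
    and S: "S = (\<Sum>i=1..l. \<bar>a i\<bar>)"
  shows "S\<^sup>2 \<le> Psi c (finite_design X l x p)"
    and "Psi c (finite_design X l x p) = S\<^sup>2 \<Longrightarrow> i \<in> {1..l} \<Longrightarrow> \<bar>a i\<bar> = p i * S"
proof -
  obtain d where d: "c = info_matrix (finite_design X l x p) *v d"
    using Xi by (auto simp: Xi_def)
  moreover have "info_matrix (finite_design X l x p) *v d = (\<Sum>i=1..l. (p i * (x i \<bullet> d)) *\<^sub>R x i)"
    by (rule info_matrix_finite_design_mult_vec) (use x_in p(1) in auto)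
  ultimately have coeffs: "(\<Sum>i=1..l. (p i * (x i \<bullet> d)) *\<^sub>R x i) = (\<Sum>i=1..l. a i *\<^sub>R x i)"
    using c by simp
  have a: "p i * (x i \<bullet> d) = a i" if "i \<in> {1..l}" for i
    by (rule independent_family_coeffs_eq[OF finite_atLeastAtMost inj ind coeffs that])
  have excess: "Psi c (finite_design X l x p) - S\<^sup>2 = (\<Sum>i=1..l. p i * (\<bar>x i \<bullet> d\<bar> - S)\<^sup>2)"
    using Psi_weighted_design[of x l X p c d] p d x_in
      weighted_squares_excess[of "{1..l}" p "\<lambda>i. x i \<bullet> d" a S] a S by simp
  have nonneg: "p i * (\<bar>x i \<bullet> d\<bar> - S)\<^sup>2 \<ge> 0" if "i \<in> {1..l}" for i
    using p(1)[OF that] by simp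
  have "(\<Sum>i=1..l. p i * (\<bar>x i \<bullet> d\<bar> - S)\<^sup>2) \<ge> 0"
    by (rule sum_nonneg) (rule nonneg)
  then show "S\<^sup>2 \<le> Psi c (finite_design X l x p)"
    using excess by simp
  assume "Psi c (finite_design X l x p) = S\<^sup>2" and i: "i \<in> {1..l}"
  then have "(\<Sum>i=1..l. p i * (\<bar>x i \<bullet> d\<bar> - S)\<^sup>2) = 0"
    using excess by simp
  then have "\<forall>i\<in>{1..l}. p i * (\<bar>x i \<bullet> d\<bar> - S)\<^sup>2 = 0"
    by (simp only: sum_nonneg_eq_0_iff[OF finite_atLeastAtMost nonneg])
  then have "p i = 0 \<or> \<bar>x i \<bullet> d\<bar> = S"
    using i by auto
  then show "\<bar>a i\<bar> = p i * S"
    using a[OF i, symmetric] p(1)[OF i] by (auto simp: abs_mult)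
qed

text \<open>
  The weights proportional to \<open>\<bar>a\<^sub>i\<bar>\<close> attain the bound: the solution \<open>d\<close> of \<open>c = M d\<close> chosen here has
  \<open>x\<^sub>i \<bullet> d = \<plusminus>S\<close> wherever \<open>a\<^sub>i \<noteq> 0\<close>, so no square contributes an excess.
\<close>

lemma optimal_weights:
  fixes x :: "nat \<Rightarrow> real^'k"
  assumes x_in: "x ` {1..l} \<subseteq> X" and inj: "inj_on x {1..l}" and ind: "independent (x ` {1..l})"
    and c: "c = (\<Sum>i=1..l. a i *\<^sub>R x i)"
    and S: "S = (\<Sum>i=1..l. \<bar>a i\<bar>)" "S > 0"
  defines "\<xi> \<equiv> finite_design X l x (\<lambda>i. \<bar>a i\<bar> / S)"
  shows "\<xi> \<in> Xi_on X c l x" and "Psi c \<xi> = S\<^sup>2"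
proof -
  let ?p = "\<lambda>i. \<bar>a i\<bar> / S"
  have p: "\<And>i. i \<in> {1..l} \<Longrightarrow> ?p i \<ge> 0" "(\<Sum>i=1..l. ?p i) = 1"
    using S by (simp_all add: sum_divide_distrib[symmetric])
  obtain d where d: "\<And>i. i \<in> {1..l} \<Longrightarrow> x i \<bullet> d = sgn (a i) * S"
    using dual_vector_exists[OF inj ind, of "\<lambda>i. sgn (a i) * S"] by blast
  have pd: "?p i * (x i \<bullet> d) = a i" if "i \<in> {1..l}" for i
    using S(2) by (simp add: d[OF that] abs_mult_sgn)
  have "info_matrix \<xi> *v d = (\<Sum>i=1..l. (?p i * (x i \<bullet> d)) *\<^sub>R x i)"
    unfolding \<xi>_def by (rule info_matrix_finite_design_mult_vec) (use x_in p(1) in auto)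
  also have "\<dots> = c"
    unfolding c by (rule sum.cong) (simp_all only: pd)
  finally have cd: "c = info_matrix \<xi> *v d"
    by (rule sym)
  show "\<xi> \<in> Xi_on X c l x"
    unfolding Xi_on_def Xi_def
    using cd supp_finite_design[OF x_in] design_finite_design[OF x_in p] by (auto simp: \<xi>_def)
  have "Psi c \<xi> = (\<Sum>i=1..l. ?p i * (x i \<bullet> d)\<^sup>2)"
    unfolding \<xi>_def by (rule Psi_weighted_design[OF x_in p cd[unfolded \<xi>_def]])
  also have "\<dots> = (\<Sum>i=1..l. \<bar>a i\<bar> * S)"
    using S(2) by (intro sum.cong) (auto simp: d power_mult_distrib power2_eq_square sgn_if)
  also have "\<dots> = S\<^sup>2"
    by (simp only: sum_distrib_right[symmetric] S(1)[symmetric] power2_eq_square)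
  finally show "Psi c \<xi> = S\<^sup>2" .
qed

lemma finite_design_cong:
  assumes "\<And>i. i \<in> {1..l} \<Longrightarrow> p i = q i" "x ` {1..l} \<subseteq> X"
  shows "finite_design X l x p = finite_design X l x q"
  by (rule measure_eqI)
    (auto simp: emeasure_finite_design[OF assms(2)] assms(1) intro!: sum.cong)

theorem proposition4p1:
  fixes X :: "(real^'k) set" and c :: "real^'k"
    and l :: nat and x :: "nat \<Rightarrow> real^'k"
  assumes X_compact: "compact X"
    and X_completion: "\<And>S. S \<subseteq> X \<Longrightarrow> S \<noteq> {} \<Longrightarrow> independent S \<Longrightarrow> card S < CARD('k) \<Longrightarrow>
          \<exists>B. S \<subseteq> B \<and> B \<subseteq> X \<and> independent B \<and> card B = CARD('k)"
    and c_nonzero: "c \<noteq> 0"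
    and l_le: "l \<le> CARD('k)"
    and x_in: "x ` {1..l} \<subseteq> X"
    and x_inj: "inj_on x {1..l}"
    and x_indep: "independent (x ` {1..l})"
    and c_span: "c \<in> span (x ` {1..l})"
  shows "(\<forall>G H. is_ginv (uniform_info X l x) G \<longrightarrow> is_ginv (uniform_info X l x) H \<longrightarrow>
            xi_star X l x c G = xi_star X l x c H \<and> z_star l x c G = z_star l x c H) \<and>
         (\<forall>G. is_ginv (uniform_info X l x) G \<longrightarrow>
            z_star l x c G \<in> line c \<and>
            xi_star X l x c G \<in> Xi X c \<and>
            (z_star l x c G \<noteq> 0 \<and>
             Psi c (xi_star X l x c G) = (norm c)\<^sup>2 / (norm (z_star l x c G))\<^sup>2) \<and>
            {\<xi>. is_arg_min (Psi c) (\<lambda>\<eta>. \<eta> \<in> Xi_on X c l x) \<xi>} = {xi_star X l x c G})"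
proof -
  obtain a where c: "c = (\<Sum>i=1..l. a i *\<^sub>R x i)"
    using span_family_coeffs[OF _ x_inj c_span] by auto
  define S where "S = (\<Sum>i=1..l. \<bar>a i\<bar>)"
  have "\<exists>i\<in>{1..l}. a i \<noteq> 0"
    using c c_nonzero by (metis (mono_tags, lifting) scaleR_zero_left sum.neutral)
  then have S_pos: "S > 0"
    unfolding S_def by (auto intro: sum_pos2)
  have l_pos: "real l > 0"
    using c c_nonzero by (cases l) auto
  let ?\<xi> = "finite_design X l x (\<lambda>i. \<bar>a i\<bar> / S)"
  note optimal = optimal_weights[OF x_in x_inj x_indep c S_def S_pos]

  have p: "p_star l x c G i = \<bar>a i\<bar> / S" and eps: "eps_star x c G i = sgn (a i)"
    if G: "is_ginv (uniform_info X l x) G" and i: "i \<in> {1..l}" for G i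
  proof -
    have coeff: "x j \<bullet> (G *v c) = real l * a j" if "j \<in> {1..l}" for j
      using ginv_coefficients[OF x_in x_inj x_indep c G that] .
    have "(\<Sum>j=1..l. \<bar>x j \<bullet> (G *v c)\<bar>) = real l * S"
      unfolding S_def sum_distrib_left by (intro sum.cong) (simp_all add: coeff abs_mult)
    then show "p_star l x c G i = \<bar>a i\<bar> / S"
      using coeff[OF i] l_pos by (simp add: p_star_def abs_mult)
    show "eps_star x c G i = sgn (a i)"
      using coeff[OF i] l_pos by (simp add: eps_star_def sgn_mult)
  qed
  have xi: "xi_star X l x c G = ?\<xi>" if "is_ginv (uniform_info X l x) G" for G
    unfolding xi_star_def by (rule finite_design_cong[OF p[OF that] x_in])
  have z: "z_star l x c G = (1 / S) *\<^sub>R c" if "is_ginv (uniform_info X l x) G" for G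
  proof -
    have "z_star l x c G = (\<Sum>i=1..l. (1 / S) *\<^sub>R (a i *\<^sub>R x i))"
      unfolding z_star_def
      by (intro sum.cong) (simp_all add: p[OF that] eps[OF that] sgn_mult_abs)
    then show ?thesis
      by (simp add: c scaleR_sum_right)
  qed

  have min: "S\<^sup>2 \<le> Psi c \<eta> \<and> (Psi c \<eta> = S\<^sup>2 \<longrightarrow> \<eta> = ?\<xi>)" if \<eta>: "\<eta> \<in> Xi_on X c l x" for \<eta>
  proof -
    obtain q where q: "\<And>i. i \<in> {1..l} \<Longrightarrow> q i \<ge> 0" "(\<Sum>i=1..l. q i) = 1"
      and eq: "\<eta> = finite_design X l x q"
      using \<eta> finite_supp_imp_finite_design[OF _ _ x_in x_inj, of \<eta>]
      by (auto simp: Xi_on_def Xi_def)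
    have "finite_design X l x q \<in> Xi X c"
      using \<eta> eq by (simp add: Xi_on_def)
    note bound = Psi_lower_bound[OF x_in x_inj x_indep c _ q(2) this S_def, OF q(1)]
    have "\<eta> = ?\<xi>" if "Psi c \<eta> = S\<^sup>2"
      unfolding eq
    proof (rule finite_design_cong[OF _ x_in])
      fix i assume "i \<in> {1..l}"
      then show "q i = \<bar>a i\<bar> / S"
        using bound(2) that S_pos by (simp add: eq)
    qed
    then show ?thesis
      using bound(1) unfolding eq by blast
  qed
  have argmin: "{\<xi>. is_arg_min (Psi c) (\<lambda>\<eta>. \<eta> \<in> Xi_on X c l x) \<xi>} = {?\<xi>}"
  proof (intro set_eqI iffI)
    fix \<eta> assume "\<eta> \<in> {\<xi>. is_arg_min (Psi c) (\<lambda>\<eta>. \<eta> \<in> Xi_on X c l x) \<xi>}"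
    then have \<eta>: "\<eta> \<in> Xi_on X c l x" and "\<not> Psi c ?\<xi> < Psi c \<eta>"
      using optimal(1) by (auto simp: is_arg_min_def)
    then have "Psi c \<eta> = S\<^sup>2"
      using min[OF \<eta>] optimal(2) by linarith
    then show "\<eta> \<in> {?\<xi>}"
      using min[OF \<eta>] by blast
  next
    fix \<eta> assume "\<eta> \<in> {?\<xi>}"
    then have "\<eta> = ?\<xi>" by simp
    moreover have "\<not> Psi c \<zeta> < Psi c ?\<xi>" if "\<zeta> \<in> Xi_on X c l x" for \<zeta>
      using min[OF that] optimal(2) by linarith
    ultimately show "\<eta> \<in> {\<xi>. is_arg_min (Psi c) (\<lambda>\<eta>. \<eta> \<in> Xi_on X c l x) \<xi>}"
      unfolding is_arg_min_def using optimal(1) by blast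
  qed

  show ?thesis
  proof (intro conjI allI impI)
    fix G H assume "is_ginv (uniform_info X l x) G" "is_ginv (uniform_info X l x) H"
    then show "xi_star X l x c G = xi_star X l x c H" "z_star l x c G = z_star l x c H"
      by (simp_all add: xi z)
  next
    fix G assume G: "is_ginv (uniform_info X l x) G"
    show "z_star l x c G \<in> line c"
      by (auto simp: z[OF G] line_def)
    show "xi_star X l x c G \<in> Xi X c"
      using optimal(1) by (simp add: xi[OF G] Xi_on_def)
    show "z_star l x c G \<noteq> 0"
      using c_nonzero S_pos by (simp add: z[OF G])
    show "Psi c (xi_star X l x c G) = (norm c)\<^sup>2 / (norm (z_star l x c G))\<^sup>2"
      using c_nonzero S_pos by (simp add: xi[OF G] z[OF G] optimal(2) power_divide)
    show "{\<xi>. is_arg_min (Psi c) (\<lambda>\<eta>. \<eta> \<in> Xi_on X c l x) \<xi>} = {xi_star X l x c G}"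
      by (simp add: argmin xi[OF G])
  qed
qed

end
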